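(* Let $G=(V,E)$ be a graph and let $I\subseteq V$ be such that $\alpha(G_I)\le 2$. Then every $X_I=(X_{ij})_{i,j\in I}\in\mathrm{STAB}^2(G_I)$ satisfies $$\sum_{\substack{i,j\in I\\ i<j}}X_{ij}\le 1 .$$
   Context: Graphs are finite, simple and undirected, with vertex set $V=\{1,\dots,n\}$ (so the sum over $i<j$ runs over each unordered pair of distinct vertices once). For $I\subseteq V$, $G_I$ is the subgraph of $G$ induced by $I$. $\alpha(H)$ is the stability number of $H$ (maximum cardinality of a set of pairwise non-adjacent vertices). For a graph $H$, $\mathcal{S}(H)\subseteq\{0,1\}^{V(H)}$ is the set of incidence vectors of stable sets of $H$ (including the empty set), $\mathcal{S}^2(H)=\{ss^\top : s\in\mathcal{S}(H)\}$, and $\mathrm{STAB}^2(H)=\mathrm{conv}\,\mathcal{S}^2(H)$. *)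

theory Defs
  imports
    "HOL-Analysis.Convex"
    "HOL-Library.Function_Algebras"
    "HOL-Library.Indicator_Function"
    "Graph_Theory.Graph_Theory"
begin

text \<open>
  A finite simple undirected graph is a digraph satisfying \<^locale>\<open>graph\<close> (finite, loop-free, no
  parallel arcs, symmetric); each edge is represented by its two opposite arcs.
  The induced subgraph is \<^const>\<open>induce_subgraph\<close>, written \<open>G \<restriction> I\<close>.
\<close>

text \<open>Pointwise scaling, so that \<^const>\<open>hull\<close> is available for matrices \<open>'a \<Rightarrow> 'a \<Rightarrow> real\<close>.\<close>

instantiation "fun" :: (type, real_vector) real_vector
begin

definition scaleR_fun_def: "c *\<^sub>R f = (\<lambda>x. c *\<^sub>R f x)"

instance
  by standard (simp_all add: scaleR_fun_def fun_eq_iff scaleR_add_right scaleR_add_left)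

end

lemma scaleR_fun_apply [simp]: "(c *\<^sub>R f) x = c *\<^sub>R f x"
  by (simp add: scaleR_fun_def)

definition stable_set :: "('a, 'b) pre_digraph \<Rightarrow> 'a set \<Rightarrow> bool" where
  "stable_set H S \<longleftrightarrow> S \<subseteq> verts H \<and> pairwise (\<lambda>u v. \<not> u \<rightarrow>\<^bsub>H\<^esub> v) S"

definition stability_number :: "('a, 'b) pre_digraph \<Rightarrow> nat" where
  "stability_number H = Max (card ` {S. stable_set H S})"

text \<open>
  Vectors and matrices indexed by the vertices of \<open>H\<close> are represented as functions on the whole
  vertex type that vanish outside \<^term>\<open>verts H\<close>. This is a linear embedding, so it commutes
  with taking convex hulls.
\<close>

definition stab_vectors :: "('a, 'b) pre_digraph \<Rightarrow> ('a \<Rightarrow> real) set" where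
  "stab_vectors H = {indicator S | S. stable_set H S}"

definition outer_square :: "('a \<Rightarrow> real) \<Rightarrow> 'a \<Rightarrow> 'a \<Rightarrow> real" where
  "outer_square s = (\<lambda>i j. s i * s j)"

definition stab_matrices :: "('a, 'b) pre_digraph \<Rightarrow> ('a \<Rightarrow> 'a \<Rightarrow> real) set" where
  "stab_matrices H = outer_square ` stab_vectors H"

definition STAB2 :: "('a, 'b) pre_digraph \<Rightarrow> ('a \<Rightarrow> 'a \<Rightarrow> real) set" where
  "STAB2 H = convex hull (stab_matrices H)"

end

theory Submission
  imports Defs
begin

text \<open>
  The left-hand side is linear in \<open>X\<close>, so the matrices that satisfy the inequality form a
  half-space, and a convex hull lies in a half-space as soon as its generators do. For a generator
  \<open>ss\<^sup>T\<close>, with \<open>s\<close> the incidence vector of a stable set \<open>S\<close>, the sum counts the pairs \<open>i < j\<close> in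
  \<open>S\<close>. As \<open>S\<close> has at most two elements, there is at most one such pair.
\<close>

lemma convex_sum_entries_le:
  fixes P :: "('a \<times> 'b) set"
  shows "convex {X :: 'a \<Rightarrow> 'b \<Rightarrow> real. (\<Sum>(i, j)\<in>P. X i j) \<le> c}"
proof (rule convexI)
  let ?f = "\<lambda>X :: 'a \<Rightarrow> 'b \<Rightarrow> real. \<Sum>(i, j)\<in>P. X i j"
  fix X Y :: "'a \<Rightarrow> 'b \<Rightarrow> real" and u v :: real
  assume XY: "X \<in> {X. ?f X \<le> c}" "Y \<in> {X. ?f X \<le> c}"
    and uv: "0 \<le> u" "0 \<le> v" "u + v = 1"
  have "?f (u *\<^sub>R X + v *\<^sub>R Y) = u * ?f X + v * ?f Y"
    by (simp add: case_prod_unfold sum.distrib sum_distrib_left)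
  also have "\<dots> \<le> c"
    using convex_bound_le[of "?f X" c "?f Y" u v] XY uv by simp
  finally show "u *\<^sub>R X + v *\<^sub>R Y \<in> {X. ?f X \<le> c}" by (simp only: mem_Collect_eq)
qed

lemma card_le_stability_number:
  assumes "finite (verts H)" "stable_set H S"
  shows "card S \<le> stability_number H"
proof -
  have "{S. stable_set H S} \<subseteq> Pow (verts H)"
    by (auto simp: stable_set_def)
  then have "finite {S. stable_set H S}"
    using assms(1) finite_subset by blast
  then show ?thesis
    unfolding stability_number_def using assms(2) by (intro Max_ge) auto
qed

text \<open>
  The two entries of an increasing pair already exhaust \<open>S\<close>, so \<open>S\<close> determines the pair as its
  minimum and maximum.
\<close>

lemma card_ordered_pairs_le_1:
  fixes S :: "'a :: linorder set"
  assumes "finite S" "card S \<le> 2"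
  shows "card {(i, j). i \<in> S \<and> j \<in> S \<and> i < j} \<le> 1"
proof -
  let ?P = "{(i, j). i \<in> S \<and> j \<in> S \<and> i < j}"
  have "finite ?P"
    by (rule finite_subset[of _ "S \<times> S"]) (use assms(1) in auto)
  moreover have "p = q" if "p \<in> ?P" "q \<in> ?P" for p q
  proof -
    obtain i j k l where p: "p = (i, j)" and q: "q = (k, l)"
      by fastforce
    have "S = {i, j}"
      using card_seteq[of S "{i, j}"] assms that p by auto
    then show "p = q"
      using that p q by auto
  qed
  ultimately show ?thesis
    by (simp add: card_le_Suc0_iff_eq)
qed

lemma sum_outer_square_indicator:
  assumes "finite P"
  shows "(\<Sum>(i, j)\<in>P. outer_square (indicator S) i j) = real (card (P \<inter> S \<times> S))"
proof -
  have "(\<Sum>(i, j)\<in>P. outer_square (indicator S) i j) = (\<Sum>p\<in>P. indicator (S \<times> S) p)"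
    by (intro sum.cong) (auto simp: outer_square_def indicator_def)
  then show ?thesis
    using assms by (simp only: indicator_def sum_of_bool_eq Collect_mem_eq)
qed

theorem lemma6:
  fixes G :: "(nat, 'b) pre_digraph" and n :: nat and I :: "nat set"
    and X :: "nat \<Rightarrow> nat \<Rightarrow> real"
  assumes "graph G" and "verts G = {1..n}"
    and "I \<subseteq> verts G"
    and "stability_number (G \<restriction> I) \<le> 2"
    and "X \<in> STAB2 (G \<restriction> I)"
  shows "(\<Sum>(i, j)\<in>{(i, j). i \<in> I \<and> j \<in> I \<and> i < j}. X i j) \<le> 1"
proof -
  let ?P = "{(i, j). i \<in> I \<and> j \<in> I \<and> i < j}"
  let ?K = "{X :: nat \<Rightarrow> nat \<Rightarrow> real. (\<Sum>(i, j)\<in>?P. X i j) \<le> 1}"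
  have finI: "finite I"
    using assms(2,3) finite_subset by fastforce
  have finP: "finite ?P"
    by (rule finite_subset[of _ "I \<times> I"]) (use finI in auto)
  have "stab_matrices (G \<restriction> I) \<subseteq> ?K"
  proof
    fix Y assume "Y \<in> stab_matrices (G \<restriction> I)"
    then obtain S where S: "stable_set (G \<restriction> I) S" and Y: "Y = outer_square (indicator S)"
      by (auto simp: stab_matrices_def stab_vectors_def)
    have "S \<subseteq> I"
      using S by (simp add: stable_set_def)
    then have pairs: "?P \<inter> S \<times> S = {(i, j). i \<in> S \<and> j \<in> S \<and> i < j}"
      by auto
    have "card S \<le> 2"
      using card_le_stability_number[OF _ S] finI assms(4) by simp
    then have "card (?P \<inter> S \<times> S) \<le> 1"
      unfolding pairs using \<open>S \<subseteq> I\<close> finI finite_subset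
      by (intro card_ordered_pairs_le_1) auto
    then show "Y \<in> ?K"
      unfolding Y by (simp add: sum_outer_square_indicator[OF finP])
  qed
  then have "STAB2 (G \<restriction> I) \<subseteq> ?K"
    unfolding STAB2_def by (intro hull_minimal convex_sum_entries_le)
  then show ?thesis
    using assms(5) by auto
qed

end
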